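(* Let $\Gamma=(\mathcal{C},\mathcal{G},\Omega)$ and $\Gamma'=(\mathcal{C}',\mathcal{G}',\Omega')$ be spined sd-categories and let $F:\Gamma\to\Gamma'$ be an sd-functor. Then for every object $X\in\mathcal{C}$, $$\mathbf{w}_{\Gamma'}(F(X))\le \mathbf{w}_\Gamma(X).$$
   Context: Graphs: a graph $G$ is a finite vertex set $V(G)$ with a symmetric irreflexive relation $E(G)\subseteq V(G)^2$; $\bullet$ is the one-vertex graph. The category $\int G$ has as objects the vertices of $G$ and the (unordered) edges of $G$; its only non-identity morphisms are, for each edge $e=xy$, two morphisms $e_x:e\to x$ and $e_y:e\to y$. (Index graphs may also be multigraphs, in which case $\int G$ has one span $x\leftarrow e\to y$ for each edge $e$, with two distinct legs even if $e$ is a loop.) Structured decompositions: a structured decomposition of shape $G$ in a category $\mathcal{C}$ is a functor $d:\int G\to\mathcal{C}$ sending every morphism to a monomorphism; the objects $d(v)$, $v\in V(G)$, are its bags. It is a structured decomposition of an object $X$ if $X\cong\operatorname{colim} d$. For a set $\mathcal{G}$ of graphs, a $\mathcal{G}$-structured decomposition is one whose shape is in $\mathcal{G}$. sd-category: a pair $(\mathcal{C},\mathcal{G})$ of a small category $\mathcal{C}$ and a set $\mathcal{G}$ of graphs with $\bullet\in\mathcal{G}$ such that (W1) every $\mathcal{G}$-structured decomposition in $\mathcal{C}$ has a colimit in $\mathcal{C}$. Spined sd-category: a triple $(\mathcal{C},\mathcal{G},\Omega)$, where $(\mathcal{C},\mathcal{G})$ is an sd-category and $\Omega=\bigcup_{n\ge0}\Omega_n$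 is a full subcategory closed under isomorphism, filtered by full subcategories $\Omega_0\subseteq\Omega_1\subseteq\cdots$ closed under isomorphism, such that (W2a) every object $X$ admits a monomorphism $X\hookrightarrow W$ with $W\in\Omega$; (W2b) for $n\ge1$ and $W\in\Omega_n\setminus\Omega_{n-1}$ there is no monomorphism from $W$ into any object of $\Omega_{n-1}$. Size and width: $s(X)$ (written $s'$ for $\Gamma'$) is the smallest $n$ such that there is a monomorphism $X\hookrightarrow W$ with $W\in\Omega_n$. The width of $d:\int G\to\mathcal{C}$ is $w(d)=\max_{x\in V(G)}s(d(x))-1$ (the maximum over the empty set being read as $0$). The $\Gamma$-width of $X$ is $\mathbf{w}_\Gamma(X)=\min_d w(d)$ over all $\mathcal{G}$-structured decompositions $d$ of $X$. sd-functor $F:\Gamma\to\Gamma'$: a functor $F:\mathcal{C}\to\mathcal{C}'$, a function $F_g:\mathcal{G}\to\mathcal{G}'$, and for each $G\in\mathcal{G}$ a functor $F_G:\int F_g(G)\to\int G$, such that (i) $s'(F(X))\le s(X)$ for all $X\in\mathcal{C}$, and (ii) whenever $d:\int G\to\mathcal{C}$ with $G\in\mathcal{G}$ is a structured decomposition of an object $X$, the composite $F_*(d)=F\circ d\circ F_G:\int F_g(G)\to\mathcal{C}'$ is a structured decomposition of $F(X)$. *)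

theory Defs
  imports Main
begin

section \<open>Categories and functors\<close>

record ('o, 'a) category =
  Ob :: "'o set"
  Ar :: "'a set"
  Dom :: "'a \<Rightarrow> 'o"
  Cod :: "'a \<Rightarrow> 'o"
  Ide :: "'o \<Rightarrow> 'a"
  Comp :: "'a \<Rightarrow> 'a \<Rightarrow> 'a"

definition hom :: "('o, 'a) category \<Rightarrow> 'o \<Rightarrow> 'o \<Rightarrow> 'a set" where
  "hom C x y = {f \<in> Ar C. Dom C f = x \<and> Cod C f = y}"

text \<open>\<open>Comp C g f\<close> is the composite of \<open>f : x \<rightarrow> y\<close> followed by \<open>g : y \<rightarrow> z\<close>. Smallness holds by
  construction, since objects and arrows form sets.\<close>

locale category =
  fixes C :: "('o, 'a) category"
  assumes dom_in: "f \<in> Ar C \<Longrightarrow> Dom C f \<in> Ob C"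
    and cod_in: "f \<in> Ar C \<Longrightarrow> Cod C f \<in> Ob C"
    and ide_in_hom: "x \<in> Ob C \<Longrightarrow> Ide C x \<in> hom C x x"
    and comp_in_hom: "f \<in> hom C x y \<Longrightarrow> g \<in> hom C y z \<Longrightarrow> Comp C g f \<in> hom C x z"
    and comp_ide_right: "f \<in> hom C x y \<Longrightarrow> Comp C f (Ide C x) = f"
    and comp_ide_left: "f \<in> hom C x y \<Longrightarrow> Comp C (Ide C y) f = f"
    and comp_assoc: "f \<in> hom C x y \<Longrightarrow> g \<in> hom C y z \<Longrightarrow> h \<in> hom C z w \<Longrightarrow>
      Comp C (Comp C h g) f = Comp C h (Comp C g f)"

definition mono_hom :: "('o, 'a) category \<Rightarrow> 'o \<Rightarrow> 'o \<Rightarrow> 'a set" where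
  "mono_hom C x y = {m \<in> hom C x y.
     \<forall>z \<in> Ob C. \<forall>f \<in> hom C z x. \<forall>g \<in> hom C z x. Comp C m f = Comp C m g \<longrightarrow> f = g}"

definition isomorphic :: "('o, 'a) category \<Rightarrow> 'o \<Rightarrow> 'o \<Rightarrow> bool" where
  "isomorphic C x y \<longleftrightarrow> x \<in> Ob C \<and> y \<in> Ob C \<and>
     (\<exists>f \<in> hom C x y. \<exists>g \<in> hom C y x. Comp C g f = Ide C x \<and> Comp C f g = Ide C y)"

record ('o, 'a, 'p, 'b) fmap =
  fob :: "'o \<Rightarrow> 'p"
  far :: "'a \<Rightarrow> 'b"

locale cat_functor = dom: category C + cod: category D
  for C :: "('o, 'a) category" and D :: "('p, 'b) category" and F :: "('o, 'a, 'p, 'b) fmap" +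
  assumes fob_in: "x \<in> Ob C \<Longrightarrow> fob F x \<in> Ob D"
    and far_in_hom: "f \<in> hom C x y \<Longrightarrow> far F f \<in> hom D (fob F x) (fob F y)"
    and far_ide: "x \<in> Ob C \<Longrightarrow> far F (Ide C x) = Ide D (fob F x)"
    and far_comp: "f \<in> hom C x y \<Longrightarrow> g \<in> hom C y z \<Longrightarrow>
      far F (Comp C g f) = Comp D (far F g) (far F f)"

definition functor_comp ::
  "('p, 'b, 'q, 'c) fmap \<Rightarrow> ('o, 'a, 'p, 'b) fmap \<Rightarrow> ('o, 'a, 'q, 'c) fmap" where
  "functor_comp G F = \<lparr>fob = fob G \<circ> fob F, far = far G \<circ> far F\<rparr>"

definition cocone ::
  "('i, 'k) category \<Rightarrow> ('o, 'a) category \<Rightarrow> ('i, 'k, 'o, 'a) fmap \<Rightarrow> 'o \<Rightarrow> ('i \<Rightarrow> 'a) \<Rightarrow> bool" where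
  "cocone J C d L \<gamma> \<longleftrightarrow> L \<in> Ob C \<and>
     (\<forall>j \<in> Ob J. \<gamma> j \<in> hom C (fob d j) L) \<and>
     (\<forall>k \<in> Ar J. Comp C (\<gamma> (Cod J k)) (far d k) = \<gamma> (Dom J k))"

definition colimit ::
  "('i, 'k) category \<Rightarrow> ('o, 'a) category \<Rightarrow> ('i, 'k, 'o, 'a) fmap \<Rightarrow> 'o \<Rightarrow> ('i \<Rightarrow> 'a) \<Rightarrow> bool" where
  "colimit J C d L \<gamma> \<longleftrightarrow> cocone J C d L \<gamma> \<and>
     (\<forall>M \<mu>. cocone J C d M \<mu> \<longrightarrow>
        (\<exists>!u. u \<in> hom C L M \<and> (\<forall>j \<in> Ob J. Comp C u (\<gamma> j) = \<mu> j)))"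


section \<open>Index graphs\<close>

text \<open>Each edge carries two distinct legs, and each leg is attached to a vertex; a loop is an edge
  both of whose legs are attached to the same vertex. Edges are thus unoriented, and parallel edges
  are allowed. A simple graph is the case in which an edge is a two-element set of vertices that
  is its own set of legs, see \<open>simple_igraph\<close> below. The edge set of a multigraph is not required
  to be finite.\<close>

record ('v, 'e, 'h) igraph =
  verts :: "'v set"
  edges :: "'e set"
  legs :: "'e \<Rightarrow> 'h set"
  endpt :: "'e \<Rightarrow> 'h \<Rightarrow> 'v"

definition index_graph :: "('v, 'e, 'h) igraph \<Rightarrow> bool" where
  "index_graph G \<longleftrightarrow> finite (verts G) \<and>
     (\<forall>e \<in> edges G. card (legs G e) = 2 \<and> (\<forall>h \<in> legs G e. endpt G e h \<in> verts G))"

definition one_vertex :: "('v, 'e, 'h) igraph \<Rightarrow> bool" where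
  "one_vertex G \<longleftrightarrow> (\<exists>v. verts G = {v}) \<and> edges G = {}"

definition simple_graph :: "'v set \<Rightarrow> ('v \<times> 'v) set \<Rightarrow> bool" where
  "simple_graph V E \<longleftrightarrow> finite V \<and> E \<subseteq> V \<times> V \<and> sym E \<and> irrefl E"

definition simple_igraph :: "'v set \<Rightarrow> ('v \<times> 'v) set \<Rightarrow> ('v, 'v set, 'v) igraph" where
  "simple_igraph V E = \<lparr>verts = V, edges = {{x, y} | x y. (x, y) \<in> E},
     legs = (\<lambda>e. e), endpt = (\<lambda>e x. x)\<rparr>"

lemma index_graph_simple: "simple_graph V E \<Longrightarrow> index_graph (simple_igraph V E)"
  unfolding simple_graph_def index_graph_def simple_igraph_def
  by (auto simp: card_insert_if irrefl_def)

datatype ('v, 'e) iob = Vertex 'v | Edge 'e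

datatype ('v, 'e, 'h) iar = Ident "('v, 'e) iob" | Leg 'e 'h

fun iar_dom :: "('v, 'e, 'h) iar \<Rightarrow> ('v, 'e) iob" where
  "iar_dom (Ident x) = x"
| "iar_dom (Leg e h) = Edge e"

fun iar_cod :: "('v, 'e, 'h) igraph \<Rightarrow> ('v, 'e, 'h) iar \<Rightarrow> ('v, 'e) iob" where
  "iar_cod G (Ident x) = x"
| "iar_cod G (Leg e h) = Vertex (endpt G e h)"

text \<open>A leg can only be precomposed with the identity of its edge.\<close>

fun iar_comp :: "('v, 'e, 'h) iar \<Rightarrow> ('v, 'e, 'h) iar \<Rightarrow> ('v, 'e, 'h) iar" where
  "iar_comp (Ident x) f = f"
| "iar_comp (Leg e h) f = Leg e h"

definition int_cat ::
  "('v, 'e, 'h) igraph \<Rightarrow> (('v, 'e) iob, ('v, 'e, 'h) iar) category" (\<open>\<integral>\<close>) where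
  "\<integral> G = \<lparr>Ob = Vertex ` verts G \<union> Edge ` edges G,
     Ar = Ident ` (Vertex ` verts G \<union> Edge ` edges G) \<union>
          {Leg e h | e h. e \<in> edges G \<and> h \<in> legs G e},
     Dom = iar_dom, Cod = iar_cod G, Ide = Ident, Comp = iar_comp\<rparr>"

lemma category_int_cat:
  assumes "index_graph G"
  shows "category (\<integral> G)"
  by unfold_locales
    (use assms in \<open>auto simp: int_cat_def hom_def index_graph_def\<close>)


section \<open>Structured decompositions\<close>

type_synonym ('v, 'e, 'h, 'o, 'a) decomp = "(('v, 'e) iob, ('v, 'e, 'h) iar, 'o, 'a) fmap"

definition structured_decomp ::
  "('o, 'a) category \<Rightarrow> ('v, 'e, 'h) igraph \<Rightarrow> ('v, 'e, 'h, 'o, 'a) decomp \<Rightarrow> bool" where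
  "structured_decomp C G d \<longleftrightarrow> cat_functor (\<integral> G) C d \<and>
     (\<forall>k \<in> Ar (\<integral> G). far d k \<in> mono_hom C (fob d (Dom (\<integral> G) k)) (fob d (Cod (\<integral> G) k)))"

definition structured_decomp_of ::
  "('o, 'a) category \<Rightarrow> ('v, 'e, 'h) igraph \<Rightarrow> ('v, 'e, 'h, 'o, 'a) decomp \<Rightarrow> 'o \<Rightarrow> bool" where
  "structured_decomp_of C G d X \<longleftrightarrow> structured_decomp C G d \<and>
     (\<exists>L \<gamma>. colimit (\<integral> G) C d L \<gamma> \<and> isomorphic C X L)"


section \<open>Spined sd-categories\<close>

locale sd_category = category C
  for C :: "('o, 'a) category" +
  fixes \<G> :: "('v, 'e, 'h) igraph set"
  assumes shapes: "G \<in> \<G> \<Longrightarrow> index_graph G"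
    and one_vertex_in: "\<exists>G \<in> \<G>. one_vertex G"
    and W1: "G \<in> \<G> \<Longrightarrow> structured_decomp C G d \<Longrightarrow> \<exists>L \<gamma>. colimit (\<integral> G) C d L \<gamma>"

text \<open>A full subcategory is given by its set of objects.\<close>

locale spined_sd_category = sd_category C \<G>
  for C :: "('o, 'a) category" and \<G> :: "('v, 'e, 'h) igraph set" +
  fixes \<Omega> :: "nat \<Rightarrow> 'o set"
  assumes Omega_subset: "\<Omega> n \<subseteq> Ob C"
    and Omega_iso: "W \<in> \<Omega> n \<Longrightarrow> isomorphic C W W' \<Longrightarrow> W' \<in> \<Omega> n"
    and Omega_Suc: "\<Omega> n \<subseteq> \<Omega> (Suc n)"
    and W2a: "X \<in> Ob C \<Longrightarrow> \<exists>W \<in> (\<Union>n. \<Omega> n). mono_hom C X W \<noteq> {}"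
    and W2b: "n \<ge> 1 \<Longrightarrow> W \<in> \<Omega> n - \<Omega> (n - 1) \<Longrightarrow> W' \<in> \<Omega> (n - 1) \<Longrightarrow> mono_hom C W W' = {}"

definition size_of :: "('o, 'a) category \<Rightarrow> (nat \<Rightarrow> 'o set) \<Rightarrow> 'o \<Rightarrow> nat" where
  "size_of C \<Omega> X = (LEAST n. \<exists>W \<in> \<Omega> n. mono_hom C X W \<noteq> {})"

definition decomp_width ::
  "('o, 'a) category \<Rightarrow> (nat \<Rightarrow> 'o set) \<Rightarrow> ('v, 'e, 'h) igraph \<Rightarrow>
   ('v, 'e, 'h, 'o, 'a) decomp \<Rightarrow> int" where
  "decomp_width C \<Omega> G d =
     (if verts G = {} then 0
      else int (Max ((\<lambda>v. size_of C \<Omega> (fob d (Vertex v))) ` verts G))) - 1"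

text \<open>The widths of decompositions of an object form a set of integers bounded below by \<open>-1\<close>
  that may be infinite, hence the least element rather than \<open>Min\<close>.\<close>

definition width ::
  "('o, 'a) category \<Rightarrow> ('v, 'e, 'h) igraph set \<Rightarrow> (nat \<Rightarrow> 'o set) \<Rightarrow> 'o \<Rightarrow> int" where
  "width C \<G> \<Omega> X = (LEAST w. \<exists>G \<in> \<G>. \<exists>d.
     structured_decomp_of C G d X \<and> w = decomp_width C \<Omega> G d)"


section \<open>Functors of spined sd-categories\<close>

locale sd_functor =
  source: spined_sd_category C \<G> \<Omega> + target: spined_sd_category C' \<G>' \<Omega>' + cat_functor C C' F
  for C :: "('o, 'a) category" and \<G> :: "('v, 'e, 'h) igraph set" and \<Omega> :: "nat \<Rightarrow> 'o set"
    and C' :: "('p, 'b) category" and \<G>' :: "('w, 'f, 'k) igraph set" and \<Omega>' :: "nat \<Rightarrow> 'p set"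
    and F :: "('o, 'a, 'p, 'b) fmap" +
  fixes Fg :: "('v, 'e, 'h) igraph \<Rightarrow> ('w, 'f, 'k) igraph"
    and FG :: "('v, 'e, 'h) igraph \<Rightarrow>
      (('w, 'f) iob, ('w, 'f, 'k) iar, ('v, 'e) iob, ('v, 'e, 'h) iar) fmap"
  assumes Fg_in: "G \<in> \<G> \<Longrightarrow> Fg G \<in> \<G>'"
    and FG_functor: "G \<in> \<G> \<Longrightarrow> cat_functor (\<integral> (Fg G)) (\<integral> G) (FG G)"
    and size_le: "X \<in> Ob C \<Longrightarrow> size_of C' \<Omega>' (fob F X) \<le> size_of C \<Omega> X"
    and pushforward: "G \<in> \<G> \<Longrightarrow> X \<in> Ob C \<Longrightarrow> structured_decomp_of C G d X \<Longrightarrow>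
      structured_decomp_of C' (Fg G) (functor_comp F (functor_comp d (FG G))) (fob F X)"

end

theory Submission
  imports Defs
begin

text \<open>Push an optimal decomposition \<open>d\<close> of \<open>X\<close> forward along \<open>F\<close>. A bag of \<open>F\<^sub>*(d)\<close> is \<open>F\<close> applied to
  \<open>d(z)\<close>, where \<open>z\<close> is a vertex or an edge of the shape of \<open>d\<close>. An edge object \<open>d(e)\<close> embeds in the
  bag at an endpoint of \<open>e\<close>, and size is monotone along monomorphisms, so in both cases the size of
  \<open>d(z)\<close>, and hence that of \<open>F(d(z))\<close>, is bounded by the size of some bag of \<open>d\<close>.\<close>

text \<open>The integers are not well-ordered, so \<open>LEAST\<close> is meaningful only for a
  satisfiable predicate with a lower bound. Subtracting the bound reduces this to minimisation over
  \<open>nat\<close>. It is applied to widths, which are all at least -1.\<close>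

lemma Least_int_bounded_below:
  fixes P :: "int \<Rightarrow> bool"
  assumes "P w" and below: "\<And>w. P w \<Longrightarrow> b \<le> w"
  shows "P (Least P) \<and> Least P \<le> w"
proof -
  obtain m where m: "P m" and min: "\<And>y. P y \<Longrightarrow> nat (m - b) \<le> nat (y - b)"
    using ex_has_least_nat[of P w "\<lambda>w. nat (w - b)"] \<open>P w\<close> by blast
  \<comment> \<open>\<open>nat\<close> truncates negative integers to 0; the bound \<open>b\<close>
    ensures that the shifted values are compared faithfully.\<close>
  have le: "m \<le> y" if "P y" for y
    using min[OF that] below[OF that] below[OF m] by linarith
  then have "Least P = m"
    by (intro Least_equality m)
  then show ?thesis
    using m le \<open>P w\<close> by simp
qed

context category
begin

lemma mono_hom_comp:
  assumes f: "f \<in> mono_hom C x y" and g: "g \<in> mono_hom C y z"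
  shows "Comp C g f \<in> mono_hom C x z"
proof -
  have fh: "f \<in> hom C x y" and gh: "g \<in> hom C y z"
    using f g by (auto simp: mono_hom_def)
  have "h = k" if "w \<in> Ob C" "h \<in> hom C w x" "k \<in> hom C w x"
    "Comp C (Comp C g f) h = Comp C (Comp C g f) k" for w h k
  proof -
    have "Comp C g (Comp C f h) = Comp C g (Comp C f k)"
      using that comp_assoc[OF _ fh gh] by metis
    then have "Comp C f h = Comp C f k"
      using g that comp_in_hom[OF _ fh] unfolding mono_hom_def by blast
    then show ?thesis
      using f that unfolding mono_hom_def by blast
  qed
  then show ?thesis
    using comp_in_hom[OF fh gh] by (auto simp: mono_hom_def)
qed

lemma ide_mono_hom: "x \<in> Ob C \<Longrightarrow> Ide C x \<in> mono_hom C x x"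
  using ide_in_hom comp_ide_left unfolding mono_hom_def by fastforce

lemma isomorphic_refl: "x \<in> Ob C \<Longrightarrow> isomorphic C x x"
  unfolding isomorphic_def using ide_in_hom comp_ide_left by blast

text \<open>The only arrow of the shape is an identity, so the constant diagram at \<open>X\<close>
  is a functor into monomorphisms and \<open>X\<close> itself is its colimit. This provides every
  object with at least one decomposition.\<close>

lemma structured_decomp_of_one_vertex:
  assumes G: "one_vertex G" "index_graph G" and X: "X \<in> Ob C"
  shows "structured_decomp_of C G \<lparr>fob = \<lambda>_. X, far = \<lambda>_. Ide C X\<rparr> X"
proof -
  let ?d = "\<lparr>fob = \<lambda>_. X, far = \<lambda>_. Ide C X\<rparr>"
  obtain v where "verts G = {v}" "edges G = {}"
    using G by (auto simp: one_vertex_def)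
  then have Ob: "Ob (\<integral> G) = {Vertex v}" and Ar: "Ar (\<integral> G) = {Ident (Vertex v)}"
    by (auto simp: int_cat_def)
  interpret J: category "\<integral> G"
    using G by (simp add: category_int_cat)
  have "cat_functor (\<integral> G) C ?d"
    by unfold_locales (use X ide_in_hom[OF X] comp_ide_left[OF ide_in_hom[OF X]] in auto)
  then have "structured_decomp C G ?d"
    by (simp add: structured_decomp_def ide_mono_hom X)
  moreover have "colimit (\<integral> G) C ?d X (\<lambda>_. Ide C X)"
    unfolding colimit_def
  proof (intro conjI allI impI)
    show "cocone (\<integral> G) C ?d X (\<lambda>_. Ide C X)"
      using X ide_in_hom[OF X] comp_ide_left[OF ide_in_hom[OF X]] by (simp add: cocone_def)
    show "\<exists>!u. u \<in> hom C X M \<and> (\<forall>j \<in> Ob (\<integral> G). Comp C u (Ide C X) = \<mu> j)"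
      if "cocone (\<integral> G) C ?d M \<mu>" for M \<mu>
    proof (rule ex1I)
      \<comment> \<open>The colimit leg is an identity, so the mediating arrow can only be the leg
        of the competing cocone at the sole vertex.\<close>
      have "\<mu> (Vertex v) \<in> hom C X M"
        using that by (simp add: cocone_def Ob)
      then show "\<mu> (Vertex v) \<in> hom C X M \<and> (\<forall>j \<in> Ob (\<integral> G). Comp C (\<mu> (Vertex v)) (Ide C X) = \<mu> j)"
        by (simp add: Ob comp_ide_right)
      show "u = \<mu> (Vertex v)"
        if "u \<in> hom C X M \<and> (\<forall>j \<in> Ob (\<integral> G). Comp C u (Ide C X) = \<mu> j)" for u
        using that by (auto simp: Ob comp_ide_right)
    qed
  qed
  ultimately show ?thesis
    unfolding structured_decomp_of_def using isomorphic_refl[OF X] by blast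
qed

end

text \<open>Precomposing with \<open>m\<close> turns an embedding of \<open>Y\<close> that realises
  its size into an embedding of \<open>X\<close> into the same spine object.\<close>

lemma (in spined_sd_category) size_of_mono:
  assumes m: "m \<in> mono_hom C X Y" and Y: "Y \<in> Ob C"
  shows "size_of C \<Omega> X \<le> size_of C \<Omega> Y"
proof -
  \<comment> \<open>This makes the \<open>LEAST\<close> in \<open>size_of\<close> an attained
    value.\<close>
  have "\<exists>n. \<exists>W \<in> \<Omega> n. mono_hom C Y W \<noteq> {}"
    using W2a[OF Y] by blast
  then have "\<exists>W \<in> \<Omega> (size_of C \<Omega> Y). mono_hom C Y W \<noteq> {}"
    unfolding size_of_def by (rule LeastI_ex)
  then have "\<exists>W \<in> \<Omega> (size_of C \<Omega> Y). mono_hom C X W \<noteq> {}"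
    using mono_hom_comp[OF m] by blast
  then show ?thesis
    unfolding size_of_def[of C \<Omega> X] by (rule Least_le)
qed

lemma decomp_width_ge: "-1 \<le> decomp_width C \<Omega> G d"
  by (simp add: decomp_width_def)

lemma width_le:
  assumes "G \<in> \<G>" "structured_decomp_of C G d X"
  shows "width C \<G> \<Omega> X \<le> decomp_width C \<Omega> G d"
  unfolding width_def
  by (rule Least_int_bounded_below[where b = "-1", THEN conjunct2])
    (use assms decomp_width_ge in blast)+

lemma (in sd_category) width_attained:
  assumes X: "X \<in> Ob C"
  obtains G d where "G \<in> \<G>" "structured_decomp_of C G d X"
    "width C \<G> \<Omega> X = decomp_width C \<Omega> G d"
proof -
  let ?P = "\<lambda>w. \<exists>G \<in> \<G>. \<exists>d. structured_decomp_of C G d X \<and> w = decomp_width C \<Omega> G d"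
  \<comment> \<open>The trivial decomposition shows that the set of widths to be minimised is
    nonempty.\<close>
  obtain G where "G \<in> \<G>" "one_vertex G"
    using one_vertex_in by blast
  then have "\<exists>w. ?P w"
    using structured_decomp_of_one_vertex[OF _ shapes X] by blast
  then obtain w where "?P w" ..
  then have "?P (Least ?P)"
    by (rule Least_int_bounded_below[where b = "-1", THEN conjunct1])
      (use decomp_width_ge in blast)
  then show ?thesis
    using that unfolding width_def by blast
qed

lemma (in spined_sd_category) size_of_le_bag:
  assumes G: "index_graph G" and d: "structured_decomp C G d" and z: "z \<in> Ob (\<integral> G)"
  obtains v where "v \<in> verts G" "size_of C \<Omega> (fob d z) \<le> size_of C \<Omega> (fob d (Vertex v))"
proof (cases z)
  case (Vertex v)
  then show ?thesis
    using that z by (auto simp: int_cat_def)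
next
  case (Edge e)
  then have e: "e \<in> edges G"
    using z by (auto simp: int_cat_def)
  with G have "card (legs G e) = 2"
    by (simp add: index_graph_def)
  \<comment> \<open>Either leg will do, and the edge may be a loop.\<close>
  then obtain h where h: "h \<in> legs G e"
    by fastforce
  with G e have v: "endpt G e h \<in> verts G"
    by (simp add: index_graph_def)
  have "Leg e h \<in> Ar (\<integral> G)"
    using e h by (simp add: int_cat_def)
  with d have "far d (Leg e h) \<in> mono_hom C (fob d (Dom (\<integral> G) (Leg e h))) (fob d (Cod (\<integral> G) (Leg e h)))"
    unfolding structured_decomp_def by blast
  then have "far d (Leg e h) \<in> mono_hom C (fob d z) (fob d (Vertex (endpt G e h)))"
    by (simp add: Edge int_cat_def)
  moreover have "fob d (Vertex (endpt G e h)) \<in> Ob C"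
    using d v cat_functor.fob_in[of "\<integral> G" C d]
    by (simp add: structured_decomp_def int_cat_def)
  ultimately show ?thesis
    using that v size_of_mono by blast
qed

lemma (in sd_functor) decomp_width_pushforward_le:
  assumes G: "G \<in> \<G>" and d: "structured_decomp C G d"
  shows "decomp_width C' \<Omega>' (Fg G) (functor_comp F (functor_comp d (FG G))) \<le> decomp_width C \<Omega> G d"
proof (cases "verts (Fg G) = {}")
  case True
  \<comment> \<open>With no bags the width is 0 - 1 = -1 by convention, the least possible
    value.\<close>
  then show ?thesis
    using decomp_width_ge[of C \<Omega> G d] by (simp add: decomp_width_def)
next
  case False
  let ?s = "\<lambda>v. size_of C \<Omega> (fob d (Vertex v))"
  let ?s' = "\<lambda>v. size_of C' \<Omega>' (fob F (fob d (fob (FG G) (Vertex v))))"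
  have fin: "finite (verts G)" and fin': "finite (verts (Fg G))"
    using source.shapes[OF G] target.shapes[OF Fg_in[OF G]] by (auto simp: index_graph_def)
  have bag: "\<exists>u \<in> verts G. ?s' v \<le> ?s u" if "v \<in> verts (Fg G)" for v
  proof -
    have z: "fob (FG G) (Vertex v) \<in> Ob (\<integral> G)"
      using cat_functor.fob_in[OF FG_functor[OF G]] that by (simp add: int_cat_def)
    then have "fob d (fob (FG G) (Vertex v)) \<in> Ob C"
      using d cat_functor.fob_in[of "\<integral> G" C d] by (simp add: structured_decomp_def)
    moreover obtain u where "u \<in> verts G" "size_of C \<Omega> (fob d (fob (FG G) (Vertex v))) \<le> ?s u"
      using source.size_of_le_bag[OF source.shapes[OF G] d z] .
    ultimately show ?thesis
      using size_le order_trans by blast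
  qed
  \<comment> \<open>Hence neither width takes the default for an empty shape, and only the two
    maxima remain to be compared.\<close>
  then have "verts G \<noteq> {}"
    using False by blast
  moreover have "Max (?s' ` verts (Fg G)) \<le> Max (?s ` verts G)"
  proof (rule Max.boundedI)
    fix a
    assume "a \<in> ?s' ` verts (Fg G)"
    then obtain u where "u \<in> verts G" "a \<le> ?s u"
      using bag by blast
    then show "a \<le> Max (?s ` verts G)"
      using fin by (meson Max_ge finite_imageI imageI order_trans)
  qed (use False fin' in auto)
  ultimately show ?thesis
    using False by (simp add: decomp_width_def functor_comp_def)
qed

theorem proposition2p7p5:
  fixes C :: "('o, 'a) category" and \<G> :: "('v, 'e, 'h) igraph set" and \<Omega> :: "nat \<Rightarrow> 'o set"
    and C' :: "('p, 'b) category" and \<G>' :: "('w, 'f, 'k) igraph set" and \<Omega>' :: "nat \<Rightarrow> 'p set"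
    and F :: "('o, 'a, 'p, 'b) fmap"
    and Fg :: "('v, 'e, 'h) igraph \<Rightarrow> ('w, 'f, 'k) igraph"
    and FG :: "('v, 'e, 'h) igraph \<Rightarrow>
      (('w, 'f) iob, ('w, 'f, 'k) iar, ('v, 'e) iob, ('v, 'e, 'h) iar) fmap"
  assumes "spined_sd_category C \<G> \<Omega>"
    and "spined_sd_category C' \<G>' \<Omega>'"
    and "sd_functor C \<G> \<Omega> C' \<G>' \<Omega>' F Fg FG"
    and "X \<in> Ob C"
  shows "width C' \<G>' \<Omega>' (fob F X) \<le> width C \<G> \<Omega> X"
proof -
  interpret sd_functor C \<G> \<Omega> C' \<G>' \<Omega>' F Fg FG
    by fact
  obtain G d where G: "G \<in> \<G>" and d: "structured_decomp_of C G d X"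
    and w: "width C \<G> \<Omega> X = decomp_width C \<Omega> G d"
    using source.width_attained[OF \<open>X \<in> Ob C\<close>] .
  \<comment> \<open>The pushforward is one of the decompositions over which the width of
    \<open>fob F X\<close> is minimised.\<close>
  have "width C' \<G>' \<Omega>' (fob F X)
      \<le> decomp_width C' \<Omega>' (Fg G) (functor_comp F (functor_comp d (FG G)))"
    by (rule width_le[OF Fg_in[OF G] pushforward[OF G \<open>X \<in> Ob C\<close> d]])
  also have "\<dots> \<le> decomp_width C \<Omega> G d"
    by (rule decomp_width_pushforward_le[OF G]) (use d in \<open>simp add: structured_decomp_of_def\<close>)
  finally show ?thesis
    by (simp add: w)
qed

end
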